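(* Let $X$ be a set of $d+2$ points in $(\mathbb{R}\cup\{-\infty\})^d$. Then there are two disjoint subsets $X_1$ and $X_2$ of $X$ whose max-plus convex hulls have a common point.
   Context: Write $\mathbb{R}_{\max}=\mathbb{R}\cup\{-\infty\}$, with $-\infty+a=-\infty$ for all $a\in\mathbb{R}_{\max}$ and $-\infty\le a$ for all $a$. For $\lambda\in\mathbb{R}_{\max}$ and $\boldsymbol{x}=(x_1,\ldots,x_d)\in\mathbb{R}_{\max}^d$, $\lambda+\boldsymbol{x}$ denotes $(\lambda+x_1,\ldots,\lambda+x_d)$; the maximum of finitely many vectors is taken componentwise. The max-plus convex hull of points $\boldsymbol{x}_1,\ldots,\boldsymbol{x}_n\in\mathbb{R}_{\max}^d$ is the set of points $\boldsymbol{x}\in\mathbb{R}_{\max}^d$ for which there exist $\lambda_1,\ldots,\lambda_n\in\mathbb{R}_{\max}$ with $\max_{i}\lambda_i=0$ and $\boldsymbol{x}=\max_{i=1,\ldots,n}(\lambda_i+\boldsymbol{x}_i)$ (in particular the hull of the empty set is empty). *)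

theory Defs
  imports "HOL-Analysis.Analysis"
begin

text \<open>The max-plus numbers are the extended reals other than \<open>\<infinity>\<close>; on them \<^typ>\<open>ereal\<close> addition
  satisfies \<open>-\<infinity> + a = -\<infinity>\<close>.\<close>

definition Rmax :: "ereal set" where
  "Rmax = UNIV - {\<infinity>}"

definition Rmax_vec :: "(ereal ^ 'd) set" where
  "Rmax_vec = {x. \<forall>j. x $ j \<in> Rmax}"

definition mp_scale :: "ereal \<Rightarrow> ereal ^ 'd \<Rightarrow> ereal ^ 'd" where
  "mp_scale l x = (\<chi> j. l + x $ j)"

text \<open>Only meaningful for a finite nonempty set of vectors, as is \<^const>\<open>Max\<close>.\<close>

definition mp_Max :: "(ereal ^ 'd) set \<Rightarrow> ereal ^ 'd" where
  "mp_Max V = (\<chi> j. Max ((\<lambda>x. x $ j) ` V))"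

text \<open>The hull of finitely many points, with the coefficients indexed by the points themselves
  (repeating a point would not change the hull). The condition \<open>V \<noteq> {}\<close> is needed because
  \<^term>\<open>Max {}\<close> is unspecified; it makes the hull of the empty set empty.\<close>

definition mp_hull :: "(ereal ^ 'd) set \<Rightarrow> (ereal ^ 'd) set" where
  "mp_hull V = {x \<in> Rmax_vec. finite V \<and> V \<noteq> {} \<and>
     (\<exists>l. (\<forall>v\<in>V. l v \<in> Rmax) \<and> Max (l ` V) = 0 \<and> x = mp_Max ((\<lambda>v. mp_scale (l v) v) ` V))}"

end

theory Submission
  imports Defs
begin

text \<open>Exponentiating turns max-plus into max-times on the nonnegative reals. For each odd \<open>k\<close>, the
  \<open>d + 2\<close> vectors of \<open>k\<close>-th powers, extended by a coordinate \<open>1\<close>, are linearly dependent in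
  dimension \<open>d + 1\<close>. Normalise the coefficients by their largest modulus and take signed \<open>k\<close>-th
  roots \<open>s\<close>. As \<open>k \<rightarrow> \<infinity>\<close> along a subsequence, \<open>s\<close> converges, and the vanishing
  \<open>k\<close>-th power sums become the balance \<open>Max (s v * y v) = Max (- s v * y v)\<close> in every
  coordinate. The points of positive and of negative \<open>s\<close> form the two sets of the partition.\<close>

lemma tendsto_Max:
  fixes f :: "'i \<Rightarrow> 'a \<Rightarrow> 'b::linorder_topology"
  assumes "finite A" "A \<noteq> {}" "\<And>a. a \<in> A \<Longrightarrow> ((\<lambda>i. f i a) \<longlongrightarrow> l a) F"
  shows "((\<lambda>i. Max (f i ` A)) \<longlongrightarrow> Max (l ` A)) F"
  using assms
proof (induction A rule: finite_ne_induct)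
  case (singleton a)
  then show ?case by simp
next
  case (insert a A)
  then show ?case by (simp add: tendsto_max)
qed

text \<open>This is Bolzano-Weierstrass for families indexed by an arbitrary finite set. Functions
  serve as vectors, with evaluation at the points of \<open>A\<close> as the coordinates.\<close>

lemma convergent_subseq_finite_family:
  fixes s :: "nat \<Rightarrow> 'a \<Rightarrow> real"
  assumes "finite A" "\<And>i a. a \<in> A \<Longrightarrow> \<bar>s i a\<bar> \<le> B"
  obtains l r where "strict_mono (r :: nat \<Rightarrow> nat)" "\<And>a. a \<in> A \<Longrightarrow> (\<lambda>i. s (r i) a) \<longlonglongrightarrow> l a"
proof -
  have "\<exists>l r. strict_mono r \<and>
      (\<forall>e>0. eventually (\<lambda>i. \<forall>a\<in>A. dist (s (r i) a) (l a) < e) sequentially)"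
    using compact_lemma_general[where f = s and basis = A and proj = "\<lambda>f a. f a" and unproj = "\<lambda>f. f"]
      assms by (force simp: bounded_iff)
  then obtain l r where "strict_mono r"
    and *: "\<And>e. e > 0 \<Longrightarrow> eventually (\<lambda>i. \<forall>a\<in>A. dist (s (r i) a) (l a) < e) sequentially"
    by blast
  have "(\<lambda>i. s (r i) a) \<longlonglongrightarrow> l a" if "a \<in> A" for a
  proof (rule tendstoI)
    fix e :: real
    assume "e > 0"
    show "eventually (\<lambda>i. dist (s (r i) a) (l a) < e) sequentially"
      using *[OF \<open>e > 0\<close>] by (rule eventually_mono) (use \<open>a \<in> A\<close> in simp)
  qed
  with \<open>strict_mono r\<close> show thesis by (rule that)
qed

text \<open>For odd \<open>k\<close> the relation expresses \<open>z v ^ k\<close> as the sum of the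
  \<open>card X - 1\<close> other terms \<open>(- z u) ^ k\<close>. Odd powers are monotone on the
  whole line, so each is at most the \<open>k\<close>-th power of the maximum. The root factor
  disappears as \<open>k\<close> grows.\<close>

lemma odd_power_sum_zero_bound:
  fixes z :: "'a \<Rightarrow> real"
  assumes "finite X" "odd k" "(\<Sum>u\<in>X. z u ^ k) = 0" "v \<in> X"
  shows "z v \<le> root k (real (card X - 1)) * Max ((\<lambda>u. - z u) ` X)"
proof -
  define M where "M = Max ((\<lambda>u. - z u) ` X)"
  have "k > 0" using \<open>odd k\<close> by (cases k) auto
  have "z v ^ k = (\<Sum>u\<in>X - {v}. (- z u) ^ k)"
    using assms by (simp add: sum.remove[of X v] sum_negf)
  also have "\<dots> \<le> (\<Sum>u\<in>X - {v}. M ^ k)"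
    using assms by (intro sum_mono power_mono_odd) (auto simp: M_def)
  also have "\<dots> = real (card X - 1) * M ^ k"
    using assms by simp
  finally have "root k (z v ^ k) \<le> root k (real (card X - 1) * M ^ k)"
    using \<open>k > 0\<close> by simp
  then show ?thesis
    using \<open>odd k\<close> by (simp add: real_root_mult odd_real_root_power_cancel M_def)
qed

lemma normalised_linear_relation:
  fixes w :: "'a \<Rightarrow> 'b::euclidean_space"
  assumes "finite X" "inj_on w X" "card X > DIM('b)"
  obtains c where "(\<Sum>v\<in>X. c v *\<^sub>R w v) = 0" "\<And>v. v \<in> X \<Longrightarrow> \<bar>c v\<bar> \<le> 1" "\<exists>v\<in>X. \<bar>c v\<bar> = 1"
proof -
  have "dependent (w ` X)"
    using assms by (intro dependent_biggerset) (simp add: card_image)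
  then obtain b where b: "\<exists>v\<in>X. b (w v) \<noteq> 0" "(\<Sum>x\<in>w ` X. b x *\<^sub>R x) = 0"
    using assms(1) by (auto simp: dependent_finite)
  define B where "B = Max ((\<lambda>v. \<bar>b (w v)\<bar>) ` X)"
  have le: "\<bar>b (w v)\<bar> \<le> B" if "v \<in> X" for v
    using that assms(1) by (simp add: B_def)
  have "B > 0" using b(1) le by force
  have "B \<in> (\<lambda>v. \<bar>b (w v)\<bar>) ` X"
    unfolding B_def using assms(1) b(1) by (intro Max_in) auto
  then have ex: "\<exists>v\<in>X. \<bar>b (w v)\<bar> = B" by auto
  have "(\<Sum>v\<in>X. (b (w v) / B) *\<^sub>R w v) = (1 / B) *\<^sub>R (\<Sum>x\<in>w ` X. b x *\<^sub>R x)"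
    by (simp add: sum.reindex[OF assms(2)] scaleR_sum_right)
  with b(2) have "(\<Sum>v\<in>X. (b (w v) / B) *\<^sub>R w v) = 0" by simp
  then show thesis
    using le ex \<open>B > 0\<close> by (intro that[of "\<lambda>v. b (w v) / B"]) auto
qed

lemma max_times_balance:
  fixes y :: "'a \<Rightarrow> real ^ 'n"
  assumes "finite X" "inj_on y X" "card X > CARD('n)"
  obtains s where "\<And>v. v \<in> X \<Longrightarrow> \<bar>s v\<bar> \<le> 1" "\<exists>v\<in>X. \<bar>s v\<bar> = 1"
    "\<And>j. Max ((\<lambda>v. s v * y v $ j) ` X) = Max ((\<lambda>v. - (s v * y v $ j)) ` X)"
proof -
  have ne: "X \<noteq> {}" using assms by auto
  have "card X > 1"
    using assms(3) zero_less_card_finite[where 'a = 'n] by linarith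
  \<comment> \<open>Odd powers and roots are mutually inverse on all of the reals, so the signs of
    the coefficients survive.\<close>
  define k where "k i = Suc (2 * i)" for i
  have "odd (k i)" "k i > 0" for i by (auto simp: k_def)
  have "\<exists>s. (\<forall>j. (\<Sum>v\<in>X. (s v * y v $ j) ^ k i) = 0) \<and> (\<forall>v\<in>X. \<bar>s v\<bar> \<le> 1) \<and> (\<exists>v\<in>X. \<bar>s v\<bar> = 1)" for i
  proof -
    define w where "w v = (\<chi> j. (y v $ j) ^ k i)" for v
    have "inj_on w X"
      using assms(2) odd_real_root_power_cancel[OF \<open>odd (k i)\<close>]
      unfolding inj_on_def w_def vec_eq_iff vec_lambda_beta by metis
    then obtain c where c: "(\<Sum>v\<in>X. c v *\<^sub>R w v) = 0" "\<And>v. v \<in> X \<Longrightarrow> \<bar>c v\<bar> \<le> 1" "\<exists>v\<in>X. \<bar>c v\<bar> = 1"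
      using normalised_linear_relation[of X w] assms by auto
    define s where "s v = root (k i) (c v)" for v
    have "(\<Sum>v\<in>X. (s v * y v $ j) ^ k i) = (\<Sum>v\<in>X. c v *\<^sub>R w v) $ j" for j
      using \<open>odd (k i)\<close> by (simp add: w_def s_def power_mult_distrib odd_real_root_pow)
    moreover have abs: "\<bar>s v\<bar> = root (k i) \<bar>c v\<bar>" for v
      using \<open>k i > 0\<close> by (simp add: s_def real_root_abs)
    have "\<forall>v\<in>X. \<bar>s v\<bar> \<le> 1" "\<exists>v\<in>X. \<bar>s v\<bar> = 1"
      unfolding abs using c(2,3) \<open>k i > 0\<close> by auto
    ultimately show ?thesis using c(1) by (intro exI[of _ s]) simp
  qed
  then obtain s where s0: "\<And>i j. (\<Sum>v\<in>X. (s i v * y v $ j) ^ k i) = 0"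
    and s1: "\<And>i v. v \<in> X \<Longrightarrow> \<bar>s i v\<bar> \<le> 1" and s2: "\<And>i. \<exists>v\<in>X. \<bar>s i v\<bar> = 1"
    by metis
  obtain l r where r: "strict_mono (r :: nat \<Rightarrow> nat)"
    and l: "\<And>v. v \<in> X \<Longrightarrow> (\<lambda>i. s (r i) v) \<longlonglongrightarrow> l v"
    by (rule convergent_subseq_finite_family[OF assms(1), of s 1]) (use s1 in auto)
  \<comment> \<open>Here \<open>card X > 1\<close> matters: the roots of 0 would not tend to
    1.\<close>
  have root: "(\<lambda>i. root (k (r i)) (real (card X - 1))) \<longlonglongrightarrow> 1"
  proof -
    have "strict_mono (k \<circ> r)"
      using r by (auto simp: strict_mono_def k_def)
    moreover have "(\<lambda>n. root n (real (card X - 1))) \<longlonglongrightarrow> 1"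
      using \<open>card X > 1\<close> by (intro LIMSEQ_root_const) simp
    ultimately show ?thesis
      using LIMSEQ_subseq_LIMSEQ by (fastforce simp: o_def)
  qed
  \<comment> \<open>The sign \<open>e\<close> yields both halves of the balance at once:
    \<open>e = 1\<close> bounds the left maximum by the right one, and \<open>e = -1\<close> the
    converse.\<close>
  have le: "e * l v * y v $ j \<le> Max ((\<lambda>u. - (e * l u * y u $ j)) ` X)"
    if "v \<in> X" "e \<in> {1, -1}" for v j and e :: real
  proof (rule LIMSEQ_le)
    show "(\<lambda>i. e * s (r i) v * y v $ j) \<longlonglongrightarrow> e * l v * y v $ j"
      using l that by (intro tendsto_intros) auto
    have "(\<lambda>i. Max ((\<lambda>u. - (e * s (r i) u * y u $ j)) ` X))
        \<longlonglongrightarrow> Max ((\<lambda>u. - (e * l u * y u $ j)) ` X)"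
      using l by (intro tendsto_Max assms(1) ne tendsto_intros) auto
    then show "(\<lambda>i. root (k (r i)) (real (card X - 1)) * Max ((\<lambda>u. - (e * s (r i) u * y u $ j)) ` X))
        \<longlonglongrightarrow> Max ((\<lambda>u. - (e * l u * y u $ j)) ` X)"
      using tendsto_mult[OF root] by fastforce
    have "(\<Sum>u\<in>X. (e * s i u * y u $ j) ^ k i) = e ^ k i * (\<Sum>u\<in>X. (s i u * y u $ j) ^ k i)" for i
      by (simp add: sum_distrib_left power_mult_distrib mult.assoc)
    then have "(\<Sum>u\<in>X. (e * s i u * y u $ j) ^ k i) = 0" for i
      using s0 by simp
    then show "\<exists>N. \<forall>i\<ge>N. e * s (r i) v * y v $ j
        \<le> root (k (r i)) (real (card X - 1)) * Max ((\<lambda>u. - (e * s (r i) u * y u $ j)) ` X)"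
      by (intro exI allI impI odd_power_sum_zero_bound[OF assms(1) \<open>odd (k _)\<close> _ that(1)])
  qed
  \<comment> \<open>The point of modulus 1 may change with \<open>i\<close>, but the maximum over a
    finite set is continuous.\<close>
  have "Max ((\<lambda>v. \<bar>l v\<bar>) ` X) = 1"
  proof (rule LIMSEQ_unique)
    show "(\<lambda>i. Max ((\<lambda>v. \<bar>s (r i) v\<bar>) ` X)) \<longlonglongrightarrow> Max ((\<lambda>v. \<bar>l v\<bar>) ` X)"
      using l by (intro tendsto_Max assms(1) ne tendsto_intros) auto
    have "Max ((\<lambda>v. \<bar>s (r i) v\<bar>) ` X) = 1" for i
      using s1 s2[of "r i"] assms(1) by (intro Max_eqI) (auto simp: image_iff)
    then show "(\<lambda>i. Max ((\<lambda>v. \<bar>s (r i) v\<bar>) ` X)) \<longlonglongrightarrow> 1" by simp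
  qed
  then have "\<And>v. v \<in> X \<Longrightarrow> \<bar>l v\<bar> \<le> 1" "\<exists>v\<in>X. \<bar>l v\<bar> = 1"
    using assms(1) ne Max_in[of "(\<lambda>v. \<bar>l v\<bar>) ` X"] Max_ge[of "(\<lambda>v. \<bar>l v\<bar>) ` X"] by auto
  moreover have "Max ((\<lambda>v. l v * y v $ j) ` X) = Max ((\<lambda>v. - (l v * y v $ j)) ` X)" for j
    using le[of _ 1 j] le[of _ "-1" j] assms(1) ne
    by (intro antisym) (auto intro!: Max.boundedI)
  ultimately show thesis using that by blast
qed

definition exp_Rmax :: "ereal \<Rightarrow> real" where
  "exp_Rmax x = (if x = -\<infinity> then 0 else exp (real_of_ereal x))"

text \<open>The value \<open>-\<infinity>\<close> on all nonpositive reals makes this function monotone on the whole line.\<close>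

definition ln_Rmax :: "real \<Rightarrow> ereal" where
  "ln_Rmax r = (if r \<le> 0 then -\<infinity> else ereal (ln r))"

lemma exp_Rmax_nonneg [simp]: "0 \<le> exp_Rmax x"
  by (simp add: exp_Rmax_def)

lemma ln_exp_Rmax: "x \<in> Rmax \<Longrightarrow> ln_Rmax (exp_Rmax x) = x"
  by (cases x) (auto simp: ln_Rmax_def exp_Rmax_def Rmax_def)

lemma ln_Rmax_in_Rmax [simp]: "ln_Rmax r \<in> Rmax"
  by (simp add: ln_Rmax_def Rmax_def)

lemma ln_Rmax_1 [simp]: "ln_Rmax 1 = 0"
  by (simp add: ln_Rmax_def)

lemma mono_ln_Rmax: "mono ln_Rmax"
  by (auto simp: mono_def ln_Rmax_def)

lemma ln_Rmax_mult: "0 \<le> a \<Longrightarrow> 0 \<le> b \<Longrightarrow> ln_Rmax (a * b) = ln_Rmax a + ln_Rmax b"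
  by (auto simp: ln_Rmax_def ln_mult mult_le_0_iff)

text \<open>Points with \<open>s v \<le> 0\<close> give products at most 0, and any point with
  \<open>s v > 0\<close> gives one at least 0, so dropping the former leaves the maximum
  unchanged.\<close>

lemma Max_restrict_positive:
  fixes s t :: "'a \<Rightarrow> real"
  assumes "finite X" "\<And>v. v \<in> X \<Longrightarrow> 0 \<le> t v" "\<exists>v\<in>X. 0 < s v"
  shows "Max ((\<lambda>v. s v * t v) ` X) = Max ((\<lambda>v. s v * t v) ` {v\<in>X. 0 < s v})"
proof (rule antisym)
  obtain p where p: "p \<in> X" "0 < s p" using assms(3) by blast
  let ?M = "Max ((\<lambda>v. s v * t v) ` {v\<in>X. 0 < s v})"
  have M: "s v * t v \<le> ?M" if "v \<in> X" "0 < s v" for v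
    using that assms(1) by (intro Max_ge) auto
  have "0 \<le> s p * t p" using p assms(2) by simp
  then have "0 \<le> ?M" using M[OF p] by linarith
  then have "s v * t v \<le> ?M" if "v \<in> X" for v
    using M[OF that] assms(2)[OF that] mult_nonpos_nonneg[of "s v" "t v"] by fastforce
  then show "Max ((\<lambda>v. s v * t v) ` X) \<le> ?M"
    using assms(1) p(1) by (subst Max_le_iff) auto
  show "?M \<le> Max ((\<lambda>v. s v * t v) ` X)"
    using assms(1) p by (intro Max_mono) auto
qed

text \<open>The hull coefficients are \<open>ln_Rmax (s v)\<close>; their maximum is 0 because
  \<open>s\<close> has maximum 1. Being monotone, \<open>ln_Rmax\<close> commutes with
  \<open>Max\<close>, and it turns products into sums. The lemma is meant for both \<open>s\<close>
  and \<open>- s\<close>.\<close>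

lemma positive_part_in_mp_hull:
  fixes X :: "(ereal ^ 'd) set"
  assumes "finite X" "X \<subseteq> Rmax_vec" "\<And>v. v \<in> X \<Longrightarrow> s v \<le> 1" "\<exists>v\<in>X. s v = 1"
  shows "(\<chi> j. ln_Rmax (Max ((\<lambda>v. s v * exp_Rmax (v $ j)) ` X))) \<in> mp_hull {v\<in>X. 0 < s v}"
proof -
  let ?P = "{v\<in>X. 0 < s v}" and ?l = "\<lambda>v. ln_Rmax (s v)"
  obtain p where p: "p \<in> X" "s p = 1" using assms(4) by blast
  have P: "finite ?P" "?P \<noteq> {}" using p assms(1) by auto
  have "Max (?l ` ?P) = ln_Rmax (Max (s ` ?P))"
    using mono_Max_commute[OF mono_ln_Rmax, of "s ` ?P"] P by (simp add: image_image)
  also have "Max (s ` ?P) = 1"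
    using p assms(1,3) by (intro Max_eqI) (auto simp: image_iff intro!: bexI[of _ p])
  finally have Max_l: "Max (?l ` ?P) = 0" by simp
  have "ln_Rmax (Max ((\<lambda>v. s v * exp_Rmax (v $ j)) ` X))
      = Max ((\<lambda>v. ?l v + v $ j) ` ?P)" for j
  proof -
    have "\<exists>v\<in>X. 0 < s v" using p by (intro bexI[of _ p]) auto
    then have "ln_Rmax (Max ((\<lambda>v. s v * exp_Rmax (v $ j)) ` X))
        = ln_Rmax (Max ((\<lambda>v. s v * exp_Rmax (v $ j)) ` ?P))"
      using Max_restrict_positive[OF assms(1), of "\<lambda>v. exp_Rmax (v $ j)" s] by simp
    also have "\<dots> = Max ((\<lambda>v. ln_Rmax (s v * exp_Rmax (v $ j))) ` ?P)"
      using mono_Max_commute[OF mono_ln_Rmax, of "(\<lambda>v. s v * exp_Rmax (v $ j)) ` ?P"] P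
      by (simp add: image_image)
    also have "(\<lambda>v. ln_Rmax (s v * exp_Rmax (v $ j))) ` ?P = (\<lambda>v. ?l v + v $ j) ` ?P"
      using assms(2) by (intro image_cong) (auto simp: ln_Rmax_mult ln_exp_Rmax Rmax_vec_def)
    finally show ?thesis .
  qed
  then have "(\<chi> j. ln_Rmax (Max ((\<lambda>v. s v * exp_Rmax (v $ j)) ` X)))
      = mp_Max ((\<lambda>v. mp_scale (?l v) v) ` ?P)"
    by (simp add: mp_Max_def mp_scale_def image_image)
  moreover have "(\<chi> j. ln_Rmax (Max ((\<lambda>v. s v * exp_Rmax (v $ j)) ` X))) \<in> Rmax_vec"
    by (simp add: Rmax_vec_def)
  moreover have "\<forall>v\<in>?P. ?l v \<in> Rmax" by simp
  ultimately show ?thesis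
    unfolding mp_hull_def using P Max_l by (intro CollectI conjI exI[of _ ?l])
qed

theorem theorem9:
  fixes X :: "(ereal ^ 'd) set"
  assumes "X \<subseteq> Rmax_vec" and "card X = CARD('d) + 2"
  shows "\<exists>X1 X2. X1 \<subseteq> X \<and> X2 \<subseteq> X \<and> X1 \<inter> X2 = {} \<and> mp_hull X1 \<inter> mp_hull X2 \<noteq> {}"
proof -
  have fin: "finite X" using assms(2) card.infinite by fastforce
  \<comment> \<open>The balance in the constant coordinate \<open>None\<close> will force the maxima
    of \<open>s\<close> and \<open>- s\<close> to agree, making both parts nonempty. It raises the
    dimension to \<open>d + 1\<close>, still below the \<open>d + 2\<close> points.\<close>
  define y :: "ereal ^ 'd \<Rightarrow> real ^ 'd option"
    where "y v = (\<chi> j. case j of None \<Rightarrow> 1 | Some i \<Rightarrow> exp_Rmax (v $ i))" for v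
  have y: "y v $ None = 1" "y v $ Some i = exp_Rmax (v $ i)" for v i
    by (simp_all add: y_def)
  have "inj_on y X"
  proof (rule inj_onI)
    fix u v assume "u \<in> X" "v \<in> X" "y u = y v"
    then have "ln_Rmax (exp_Rmax (u $ i)) = ln_Rmax (exp_Rmax (v $ i))" for i
      by (metis y(2))
    then show "u = v"
      using \<open>u \<in> X\<close> \<open>v \<in> X\<close> assms(1) by (auto simp: vec_eq_iff Rmax_vec_def ln_exp_Rmax subset_iff)
  qed
  moreover have "card X > CARD('d option)" using assms(2) by simp
  ultimately obtain s where s1: "\<And>v. v \<in> X \<Longrightarrow> \<bar>s v\<bar> \<le> 1" and s2: "\<exists>v\<in>X. \<bar>s v\<bar> = 1"
    and bal: "\<And>j. Max ((\<lambda>v. s v * y v $ j) ` X) = Max ((\<lambda>v. - (s v * y v $ j)) ` X)"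
    using max_times_balance[OF fin] by blast
  have ne: "X \<noteq> {}" using s2 by auto
  have bal1: "Max (s ` X) = Max ((\<lambda>v. - s v) ` X)"
    using bal[of None] by (simp add: y)
  have ub: "Max (s ` X) \<le> 1"
    using s1 fin ne by (subst Max_le_iff) (auto simp: abs_le_iff)
  \<comment> \<open>A point of modulus 1 has \<open>s v = 1\<close> or \<open>- s v = 1\<close>; by
    \<open>bal1\<close> either case bounds both maxima from below.\<close>
  have "1 \<le> Max (s ` X)"
  proof -
    obtain v where v: "v \<in> X" "s v = 1 \<or> - s v = 1" using s2 by (auto simp: abs_if split: if_splits)
    then show ?thesis
      using Max_ge[of "s ` X" "s v"] Max_ge[of "(\<lambda>v. - s v) ` X" "- s v"] bal1 fin by auto
  qed
  with ub have "Max (s ` X) = 1" "Max ((\<lambda>v. - s v) ` X) = 1" using bal1 by auto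
  then have ex: "\<exists>v\<in>X. s v = 1" "\<exists>v\<in>X. - s v = 1"
    using Max_in[of "s ` X"] Max_in[of "(\<lambda>v. - s v) ` X"] fin ne by auto
  let ?x = "\<chi> j. ln_Rmax (Max ((\<lambda>v. s v * exp_Rmax (v $ j)) ` X))"
  have "?x \<in> mp_hull {v\<in>X. 0 < s v}"
    using s1 ex by (intro positive_part_in_mp_hull fin assms(1)) (auto simp: abs_le_iff)
  moreover have "(\<chi> j. ln_Rmax (Max ((\<lambda>v. - s v * exp_Rmax (v $ j)) ` X))) \<in> mp_hull {v\<in>X. 0 < - s v}"
    using s1 ex by (intro positive_part_in_mp_hull fin assms(1)) (auto simp: abs_le_iff)
  \<comment> \<open>The balance in the coordinates \<open>Some i\<close> identifies the hull points
    obtained from \<open>s\<close> and from \<open>- s\<close>.\<close>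
  moreover have "(\<chi> j. ln_Rmax (Max ((\<lambda>v. - s v * exp_Rmax (v $ j)) ` X))) = ?x"
    using bal[of "Some _"] by (simp add: y)
  ultimately have "?x \<in> mp_hull {v\<in>X. 0 < s v} \<inter> mp_hull {v\<in>X. 0 < - s v}" by simp
  then show ?thesis
    by (intro exI[of _ "{v\<in>X. 0 < s v}"] exI[of _ "{v\<in>X. 0 < - s v}"]) auto
qed

end
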